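(* Let $p$ be a prime and $q>p$ an integer not divisible by $p$. Let $m=\lfloor q/p\rfloor$, let $\bar q\in\{1,\ldots,p-1\}$ be the residue of $q$ modulo $p$, let $g\in\mathbb{Z}_p$ with $g\ne 0$ and $g\neq 1$, and let $b_g\in\{0,1,\ldots,p-1\}$ be defined by $b_g\equiv (g-1)^{-1}\bar q \pmod p$. Let $s_g(t)$ and $s_1(t)$ be the CRT sequences of length $L=pq$ generated by $g$ and $1$, and $H_{g1}(\tau)=\sum_{t=0}^{L-1}s_g(t)s_1(t-\tau)$. Then for every delay offset $\tau\in\mathbb{Z}_L$: $$m-1\le H_{g1}(\tau)\le m+1\quad\text{if } 0<b_g<p-\bar q,$$ $$m\le H_{g1}(\tau)\le m+2\quad\text{if } p-\bar q<b_g<p.$$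
   Context: Sequences of length $L=pq$ are indexed by $\mathbb{Z}_L$, with $t-\tau$ computed modulo $L$. Put $G_{p,q}=\mathbb{Z}_p\oplus\mathbb{Z}_q$ and let $\Phi_{p,q}:\mathbb{Z}_{pq}\to G_{p,q}$, $\Phi_{p,q}(x)=(x \bmod p,\ x\bmod q)$. For $g\in\mathbb{Z}_p$ let $\mathcal{I}_{g,p,q}=\{(gt \bmod p,\ t)\in G_{p,q}: 0\le t<q\}$. The CRT sequence generated by $g$ is the binary sequence $s_g(t)$ of length $pq$ with $s_g(t)=1$ if $\Phi_{p,q}(t)\in\mathcal{I}_{g,p,q}$ and $s_g(t)=0$ otherwise. *)

theory Defs
  imports "HOL-Number_Theory.Number_Theory"
begin

text \<open>Residue classes modulo \<open>n\<close> are represented by the integers in \<open>{0..<n}\<close>.\<close>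

definition crt_map :: "int \<Rightarrow> int \<Rightarrow> int \<Rightarrow> int \<times> int" where
  "crt_map p q x = (x mod p, x mod q)"

text \<open>The second coordinate ranges over the representatives \<open>0, \<dots>, q - 1\<close>, and the product
  in the first coordinate is formed from these: \<open>t \<mapsto> g * t mod p\<close> does not descend
  to residue classes modulo \<open>q\<close>.\<close>

definition crt_set :: "int \<Rightarrow> int \<Rightarrow> int \<Rightarrow> (int \<times> int) set" where
  "crt_set g p q = {(g * t mod p, t) | t. 0 \<le> t \<and> t < q}"

definition crt_seq :: "int \<Rightarrow> int \<Rightarrow> int \<Rightarrow> int \<Rightarrow> int" where
  "crt_seq p q g t = (if crt_map p q t \<in> crt_set g p q then 1 else 0)"

definition cross_correlation :: "int \<Rightarrow> (int \<Rightarrow> int) \<Rightarrow> (int \<Rightarrow> int) \<Rightarrow> int \<Rightarrow> int" where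
  "cross_correlation L s s' \<tau> = (\<Sum>t\<in>{0..<L}. s t * s' ((t - \<tau>) mod L))"

end

theory Submission
  imports Defs
begin

text \<open>The Chinese remainder theorem lets us index the coincidences by \<open>y = t mod q\<close>. With
  \<open>k = \<tau> mod q\<close>, a coincidence at \<open>y\<close> means \<open>y \<equiv> c\<close> modulo \<open>p\<close> if \<open>k \<le> y\<close> and
  \<open>y \<equiv> c + b\<close> if \<open>y < k\<close>, where \<open>c = (g - 1)\<^sup>-\<^sup>1 (\<tau> - k) mod p\<close>; the shift by \<open>b\<close> comes from the
  wraparound modulo \<open>q\<close>. Counting residues in initial intervals gives
  \<open>H \<tau> = m + [c < qbar] - [c < k mod p] + [(c + b) mod p < k mod p]\<close>,
  and the two ranges for \<open>b\<close> each exclude one extreme value.\<close>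

lemma card_residue_class:
  fixes p r k :: int
  assumes "0 \<le> r" "r < p" "0 \<le> k"
  shows "int (card {y \<in> {0..<k}. y mod p = r}) = k div p + of_bool (r < k mod p)"
  using assms(3)
proof (induction k rule: int_ge_induct)
  case base
  then show ?case using assms by simp
next
  case (step k)
  have p: "0 < p" using assms by simp
  have k: "p * (k div p) + k mod p = k" by simp
  have bnd: "0 \<le> k mod p" "k mod p < p" using p by simp_all
  have eq: "{y \<in> {0..<k + 1}. y mod p = r} =
      {y \<in> {0..<k}. y mod p = r} \<union> (if k mod p = r then {k} else {})"
    using step.hyps by (auto simp: order_le_less)
  have card: "int (card {y \<in> {0..<k + 1}. y mod p = r}) =
      int (card {y \<in> {0..<k}. y mod p = r}) + of_bool (k mod p = r)"
    unfolding eq by (subst card_Un_disjoint) (simp_all del: atLeastLessThan_iff, simp)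
  show ?case
  \<comment> \<open>The quotient grows only when \<open>k mod p = p - 1\<close>. The remainder then
    drops to 0, and exactly one of \<open>r < p - 1\<close> and \<open>r = p - 1\<close> holds,
    which makes up for the extra 1.\<close>
  proof (cases "k mod p = p - 1")
    case True
    then have "k + 1 = p * (k div p + 1)" unfolding distrib_left using k by linarith
    then have "(k + 1) div p = k div p + 1" "(k + 1) mod p = 0"
      using p by (metis nonzero_mult_div_cancel_left less_irrefl, metis mod_mult_self1_is_0)
    then show ?thesis using True card step.IH assms by auto
  next
    case False
    then have "k + 1 = p * (k div p) + (k mod p + 1)" "0 \<le> k mod p + 1" "k mod p + 1 < p"
      using bnd k by linarith+
    then have "(k + 1) div p = k div p" "(k + 1) mod p = k mod p + 1"
      by (fact int_div_pos_eq, fact int_mod_pos_eq)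
    then show ?thesis using card step.IH by auto
  qed
qed

lemma crt_seq_iff:
  fixes p q g t :: int
  assumes "0 < q"
  shows "crt_seq p q g t = of_bool ([t = g * (t mod q)] (mod p))"
  using assms by (auto simp: crt_seq_def crt_map_def crt_set_def cong_def)

text \<open>By the Chinese remainder theorem the support of \<open>crt_seq p q g\<close> meets each
  class modulo \<open>q\<close> exactly once, since on it \<open>t mod q\<close> determines
  \<open>t mod p\<close>. So \<open>f\<close> has to be known only on that support, where it may be
  expressed through \<open>t mod q\<close>.\<close>

lemma sum_crt_seq_mult:
  fixes p q g :: int and P :: "int \<Rightarrow> bool"
  assumes "0 < p" "0 < q" "coprime p q"
    and P: "\<And>t. t \<in> {0..<p * q} \<Longrightarrow> [t = g * (t mod q)] (mod p) \<Longrightarrow> f t = of_bool (P (t mod q))"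
  shows "(\<Sum>t\<in>{0..<p * q}. crt_seq p q g t * f t) = int (card {y \<in> {0..<q}. P y})"
proof -
  let ?T = "{t \<in> {0..<p * q}. [t = g * (t mod q)] (mod p) \<and> P (t mod q)}"
  have "(\<Sum>t\<in>{0..<p * q}. crt_seq p q g t * f t) = (\<Sum>t\<in>{0..<p * q}. of_bool (t \<in> ?T))"
    by (rule sum.cong) (auto simp: crt_seq_iff assms)
  also have "\<dots> = int (card ?T)"
    by (simp add: of_bool_def sum.If_cases Int_def)
  also have "card ?T = card {y \<in> {0..<q}. P y}"
  proof (rule bij_betw_same_card[where f = "\<lambda>t. t mod q"], rule bij_betw_imageI)
    show "inj_on (\<lambda>t. t mod q) ?T"
    proof (rule inj_onI)
      fix t u assume tu: "t \<in> ?T" "u \<in> ?T" "t mod q = u mod q"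
      then have "[t = u] (mod p)" "[t = u] (mod q)"
        by (auto simp: cong_def)
      then have "[t = u] (mod p * q)"
        using assms(3) coprime_cong_mult by blast
      then show "t = u" using tu by (simp add: cong_def)
    qed
    show "(\<lambda>t. t mod q) ` ?T = {y \<in> {0..<q}. P y}"
    proof
      show "(\<lambda>t. t mod q) ` ?T \<subseteq> {y \<in> {0..<q}. P y}" using assms by auto
      show "{y \<in> {0..<q}. P y} \<subseteq> (\<lambda>t. t mod q) ` ?T"
      proof
        fix y assume y: "y \<in> {y \<in> {0..<q}. P y}"
        obtain x where x: "[x = g * y] (mod p)" "[x = y] (mod q)"
          using binary_chinese_remainder_int[OF assms(3)] by blast
        define t where "t = x mod (p * q)"
        have "t mod q = y" using x y by (simp add: t_def cong_def mod_mod_cancel)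
        moreover have "[t = g * y] (mod p)"
          using x by (simp add: t_def cong_def mod_mod_cancel)
        moreover have "t \<in> {0..<p * q}" using assms by (simp add: t_def)
        ultimately show "y \<in> (\<lambda>t. t mod q) ` ?T" using y by (intro image_eqI[of _ _ t]) auto
      qed
    qed
  qed
  finally show ?thesis .
qed

text \<open>The integer value is needed, not just its class modulo \<open>q\<close>:
  \<open>crt_seq\<close> reduces this representative modulo \<open>p\<close>, where a borrowed
  \<open>q\<close> changes the residue.\<close>

lemma mod_diff_cases:
  fixes q t \<tau> :: int
  assumes "0 < q"
  shows "(t - \<tau>) mod q = t mod q - \<tau> mod q + (if t mod q < \<tau> mod q then q else 0)"
proof -
  have "(t - \<tau>) mod q = (t mod q - \<tau> mod q + (if t mod q < \<tau> mod q then q else 0)) mod q"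
    by (simp add: mod_simps)
  also have "\<dots> = t mod q - \<tau> mod q + (if t mod q < \<tau> mod q then q else 0)"
    using pos_mod_bound[OF assms, of t] pos_mod_bound[OF assms, of \<tau>]
      pos_mod_sign[OF assms, of t] pos_mod_sign[OF assms, of \<tau>]
    by (intro mod_pos_pos_trivial; cases "t mod q < \<tau> mod q"; simp only: if_True if_False; linarith)
  finally show ?thesis .
qed

lemma cross_correlation_crt_seq_1:
  fixes p q g h \<tau> :: int
  assumes "0 < p" "0 < q" "coprime p q" and h: "[h * (g - 1) = 1] (mod p)"
  defines "k \<equiv> \<tau> mod q"
  defines "c \<equiv> h * (\<tau> - k) mod p"
  shows "cross_correlation (p * q) (crt_seq p q g) (crt_seq p q 1) \<tau> =
    q div p + of_bool (c < q mod p) - of_bool (c < k mod p)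
      + of_bool ((c + h * q) mod p < k mod p)"
proof -
  let ?P = "\<lambda>y. if y < k then y mod p = (c + h * q) mod p else y mod p = c"
  have k: "0 \<le> k" "k < q" using assms by (simp_all add: k_def)
  have c: "0 \<le> c" "c < p" using assms by (simp_all add: c_def)
  \<comment> \<open>Since \<open>h\<close> inverts \<open>g - 1\<close> modulo \<open>p\<close>,
    each coincidence condition becomes a single residue class for \<open>y\<close>.\<close>
  have solve: "[(g - 1) * y = x] (mod p) \<longleftrightarrow> y mod p = h * x mod p" for x y
  proof
    assume "[(g - 1) * y = x] (mod p)"
    then have "[h * ((g - 1) * y) = h * x] (mod p)" by (rule cong_scalar_left)
    moreover have "[h * (g - 1) * y = 1 * y] (mod p)" using h by (rule cong_scalar_right)
    ultimately show "y mod p = h * x mod p" by (simp add: cong_def mult.assoc)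
  next
    assume "y mod p = h * x mod p"
    then have "[(g - 1) * y = (g - 1) * (h * x)] (mod p)"
      using cong_scalar_left cong_def by metis
    moreover have "[h * (g - 1) * x = 1 * x] (mod p)" using h by (rule cong_scalar_right)
    ultimately show "[(g - 1) * y = x] (mod p)" by (simp add: cong_def ac_simps)
  qed
  have "cross_correlation (p * q) (crt_seq p q g) (crt_seq p q 1) \<tau> =
      int (card {y \<in> {0..<q}. ?P y})"
    unfolding cross_correlation_def
  proof (rule sum_crt_seq_mult[OF assms(1-3)])
    fix t assume t: "t \<in> {0..<p * q}" "[t = g * (t mod q)] (mod p)"
    define e where "e = (if t mod q < k then q else 0)"
    have "[(t - \<tau>) mod (p * q) = 1 * ((t - \<tau>) mod (p * q) mod q)] (mod p) \<longleftrightarrow>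
        [t - \<tau> = t mod q - k + e] (mod p)"
      using mod_diff_cases[OF assms(2), of t \<tau>]
      by (simp add: cong_def mod_mod_cancel k_def e_def)
    \<comment> \<open>On the support of \<open>crt_seq p q g\<close>, \<open>t\<close> may be
      replaced by \<open>g * (t mod q)\<close> modulo \<open>p\<close>, leaving a condition on
      \<open>t mod q\<close> alone.\<close>
    also have "\<dots> \<longleftrightarrow> [g * (t mod q) - \<tau> = t mod q - k + e] (mod p)"
      using cong_diff[OF t(2) cong_refl[of \<tau>]] cong_trans cong_sym by blast
    also have "\<dots> \<longleftrightarrow> [(g - 1) * (t mod q) = (\<tau> - k) + e] (mod p)"
      by (simp add: cong_iff_dvd_diff algebra_simps)
    also have "\<dots> \<longleftrightarrow> (t mod q) mod p = h * (\<tau> - k + e) mod p"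
      by (rule solve)
    also have "h * (\<tau> - k + e) mod p = (c + h * e) mod p"
      by (simp add: c_def mod_simps distrib_left)
    also have "(t mod q) mod p = (c + h * e) mod p \<longleftrightarrow> ?P (t mod q)"
      using c by (simp add: e_def)
    finally show "crt_seq p q 1 ((t - \<tau>) mod (p * q)) = of_bool (?P (t mod q))"
      using assms by (simp only: crt_seq_iff)
  qed
  \<comment> \<open>The part with \<open>k \<le> y\<close> is written as a difference of initial
    intervals, so that \<open>card_residue_class\<close> applies; the two \<open>k div p\<close>
    terms then cancel.\<close>
  also have "{y \<in> {0..<q}. ?P y} = {y \<in> {0..<k}. y mod p = (c + h * q) mod p} \<union>
      ({y \<in> {0..<q}. y mod p = c} - {y \<in> {0..<k}. y mod p = c})"
    using k by auto
  also have "int (card \<dots>) = int (card {y \<in> {0..<k}. y mod p = (c + h * q) mod p}) +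
      (int (card {y \<in> {0..<q}. y mod p = c}) - int (card {y \<in> {0..<k}. y mod p = c}))"
  proof -
    have sub: "{y \<in> {0..<k}. y mod p = c} \<subseteq> {y \<in> {0..<q}. y mod p = c}" using k by auto
    have fin: "finite {y \<in> {0..<q}. y mod p = c}" "finite {y \<in> {0..<k}. y mod p = c}"
      "finite {y \<in> {0..<k}. y mod p = (c + h * q) mod p}"
      by (simp_all del: atLeastLessThan_iff)
    have "int (card ({y \<in> {0..<q}. y mod p = c} - {y \<in> {0..<k}. y mod p = c})) =
        int (card {y \<in> {0..<q}. y mod p = c}) - int (card {y \<in> {0..<k}. y mod p = c})"
      using card_Diff_subset[OF fin(2) sub] card_mono[OF fin(1) sub] by simp
    then show ?thesis
      using fin by (subst card_Un_disjoint) auto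
  qed
  also have "\<dots> = q div p + of_bool (c < q mod p) - of_bool (c < k mod p)
      + of_bool ((c + h * q) mod p < k mod p)"
    using card_residue_class[of c p k] card_residue_class[of c p q]
      card_residue_class[of "(c + h * q) mod p" p k] c k assms(1) by simp
  finally show ?thesis .
qed

theorem theorem3:
  fixes p q m qbar g b \<tau> :: int
  assumes "prime p"
    and "q > p"
    and "\<not> p dvd q"
    and "m = q div p"
    and "qbar = q mod p"
    and "g \<in> {0..<p}"
    and "g \<noteq> 0"
    and "g \<noteq> 1"
    and "b \<in> {0..<p}"
    and "[b = modular_inverse p (g - 1) * qbar] (mod p)"
    and "\<tau> \<in> {0..<p * q}"
  defines "H \<equiv> cross_correlation (p * q) (crt_seq p q g) (crt_seq p q 1)"
  shows "(0 < b \<and> b < p - qbar \<longrightarrow> m - 1 \<le> H \<tau> \<and> H \<tau> \<le> m + 1) \<and>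
         (p - qbar < b \<and> b < p \<longrightarrow> m \<le> H \<tau> \<and> H \<tau> \<le> m + 2)"
proof -
  define h where "h = modular_inverse p (g - 1)"
  define k where "k = \<tau> mod q"
  define c where "c = h * (\<tau> - k) mod p"
  have p: "0 < p" "0 < q" using assms(2) prime_gt_0_int[OF assms(1)] by simp_all
  have c: "0 \<le> c" "c < p" using p by (simp_all add: c_def)
  have "\<not> p dvd g - 1" using assms(6-8) by (auto dest: zdvd_imp_le)
  then have "coprime (g - 1) p"
    using assms(1) prime_imp_coprime coprime_commute by blast
  then have h: "[h * (g - 1) = 1] (mod p)"
    unfolding h_def using cong_modular_inverse2 by blast
  have "coprime p q" using assms(1,3) prime_imp_coprime by blast
  from cross_correlation_crt_seq_1[OF p this h, of \<tau>]
  have H: "H \<tau> = m + of_bool (c < qbar) - of_bool (c < k mod p)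
      + of_bool ((c + h * q) mod p < k mod p)"
    by (simp add: H_def assms(4,5) c_def k_def)
  have "(c + h * q) mod p = (c + b) mod p"
    using assms(5,10) by (metis cong_def h_def mod_add_right_eq mod_mult_right_eq)
  also have "\<dots> = c + b - (if c + b < p then 0 else p)"
    using c assms(9) mod_pos_pos_trivial[of "c + b - p" p] by auto
  \<comment> \<open>Let \<open>r = k mod p\<close>. The value \<open>m + 2\<close> needs
    \<open>r \<le> c < qbar\<close> and \<open>(c + b) mod p < r\<close>, hence a wraparound
    \<open>p \<le> c + b\<close>, impossible if \<open>b < p - qbar\<close>. The value
    \<open>m - 1\<close> needs \<open>qbar \<le> c < r \<le> (c + b) mod p\<close>, hence
    \<open>c + b < p\<close>, impossible if \<open>p - qbar < b\<close>.\<close>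
  finally show ?thesis
    unfolding H using c assms(9) by auto
qed

end
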